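(* Let $q$ be a positive integer, and let $A,B\subset\mathbb{Z}_q$ be nonempty sets with $|A|=\alpha q$, $|B|=\beta q$ and $\alpha\ge\beta$. Suppose that the least prime factor of $q$ is greater than $2\beta^{-1}+3$. Then there is a positive integer $d$ (not necessarily a divisor of $q$) with $$d\le\alpha^{-\beta^{-1}-1}$$ such that $$d\cdot\mathbb{Z}_q\subseteq(A-A)(B-B).$$
   Context: $\mathbb{Z}_q=\mathbb{Z}/q\mathbb{Z}$. For $X,Y\subseteq\mathbb{Z}_q$: $X-Y=\{x-y: x\in X, y\in Y\}$, $XY=\{xy: x\in X,y\in Y\}$, and $d\cdot X=\{dx: x\in X\}$. *)

theory Defs
  imports
    "HOL-Library.Extended_Real"
    "HOL-Algebra.Coset"
    "HOL-Number_Theory.Number_Theory"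
begin

(* Modulus 1 gives the zero ring. There the field one of residue_ring lies outside the
   carrier, so only the additive structure and the multiplication are used below. *)
abbreviation Zmod :: "nat \<Rightarrow> int ring"
  where "Zmod q \<equiv> residue_ring (int q)"

definition difference_set :: "('a, 'b) ring_scheme \<Rightarrow> 'a set \<Rightarrow> 'a set \<Rightarrow> 'a set"
  where "difference_set R X Y = {x \<ominus>\<^bsub>R\<^esub> y | x y. x \<in> X \<and> y \<in> Y}"

definition dilate :: "('a, 'b) ring_scheme \<Rightarrow> nat \<Rightarrow> 'a set \<Rightarrow> 'a set"
  where "dilate R d X = {[d] \<cdot>\<^bsub>R\<^esub> x | x. x \<in> X}"

(* The infimum over the empty set is \<infinity>, so 1 has least prime factor \<infinity>. *)
definition least_prime_factor :: "nat \<Rightarrow> ereal"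
  where "least_prime_factor q = (INF p \<in> prime_factors q. ereal (real p))"

lemma carrier_Zmod: "carrier (Zmod q) = {0..<int q}"
  by (auto simp: residue_ring_def)

lemma abelian_group_Zmod:
  assumes "q > 0"
  shows "abelian_group (Zmod q)"
proof (rule abelian_groupI)
  fix x assume x: "x \<in> carrier (Zmod q)"
  have "(- x) mod int q \<in> carrier (Zmod q)" "(- x) mod int q \<oplus>\<^bsub>Zmod q\<^esub> x = \<zero>\<^bsub>Zmod q\<^esub>"
    using assms by (auto simp: carrier_Zmod residue_ring_def mod_simps)
  then show "\<exists>y\<in>carrier (Zmod q). y \<oplus>\<^bsub>Zmod q\<^esub> x = \<zero>\<^bsub>Zmod q\<^esub>" by blast
next
  fix x y
  show "x \<oplus>\<^bsub>Zmod q\<^esub> y \<in> carrier (Zmod q)"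
    using assms by (simp add: carrier_Zmod) (simp add: residue_ring_def)
qed (use assms in \<open>auto simp: residue_ring_def mod_simps algebra_simps\<close>)

lemma minus_Zmod:
  assumes "x \<in> carrier (Zmod q)" "y \<in> carrier (Zmod q)"
  shows "x \<ominus>\<^bsub>Zmod q\<^esub> y = (x - y) mod int q"
proof -
  have q: "q > 0" using assms by (auto simp: carrier_Zmod)
  interpret abelian_group "Zmod q" by (rule abelian_group_Zmod[OF q])
  have "(- y) mod int q \<in> carrier (Zmod q)" "(- y) mod int q \<oplus>\<^bsub>Zmod q\<^esub> y = \<zero>\<^bsub>Zmod q\<^esub>"
    using q by (auto simp: carrier_Zmod residue_ring_def mod_simps)
  then have "\<ominus>\<^bsub>Zmod q\<^esub> y = (- y) mod int q"
    using assms(2) minus_equality by blast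
  then show ?thesis
    by (simp add: a_minus_def residue_ring_def mod_simps)
qed

lemma dilate_Zmod:
  assumes "X \<subseteq> carrier (Zmod q)"
  shows "dilate (Zmod q) d X = {(int d * x) mod int q | x. x \<in> X}"
proof -
  have "[d] \<cdot>\<^bsub>Zmod q\<^esub> x = (int d * x) mod int q" if "x \<in> X" for x
    by (induction d)
       (auto simp: add_pow_def nat_pow_def residue_ring_def mod_simps algebra_simps)
  then show ?thesis by (force simp: dilate_def)
qed

lemma set_mult_Zmod: "X <#>\<^bsub>Zmod q\<^esub> Y = {(x * y) mod int q | x y. x \<in> X \<and> y \<in> Y}"
  by (auto simp: set_mult_def residue_ring_def)

lemma least_prime_factor_eq_Min:
  assumes "q > 1"
  shows "least_prime_factor q = ereal (real (Min (prime_factors q)))"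
proof -
  have ne: "prime_factors q \<noteq> {}" using assms by (simp add: prime_factorization_empty_iff)
  show ?thesis unfolding least_prime_factor_def
    by (rule antisym) (use ne in \<open>auto intro!: INF_lower INF_greatest\<close>)
qed

end

theory Submission
  imports Defs
begin

text \<open>
  Let $n = \lfloor 1/\beta \rfloor$; all of $1, \dots, n$ are units modulo $q$. More than $q^n / |A|^n$
  translates of $A^n$ by multiples of $(1, 1/2, \dots, 1/n)$ cannot be disjoint, so some
  $d \le \alpha^{-n}$ has $d/j \in A - A$ for all $j \le n$ at once. In the same way, for each $x$ two of
  the translates $B, B + x, \dots, B + nx$ meet, so $jx \in B - B$ for some $1 \le j \le n$. Then
  $dx = (d/j)(jx)$.
\<close>

lemma simultaneous_multiple_in_difference_set:
  fixes q D :: nat and A :: "int set" and S :: "'i set" and v :: "'i \<Rightarrow> int"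
  assumes "finite S" and q: "q > 0" and A: "A \<subseteq> {0..<int q}"
    and big: "q ^ card S < Suc D * card A ^ card S"
  obtains d where "1 \<le> d" "d \<le> D"
    "\<And>j. j \<in> S \<Longrightarrow> \<exists>a\<in>A. \<exists>a'\<in>A. (int d * v j) mod int q = (a - a') mod int q"
proof -
  \<comment> \<open>\<open>T\<close> lists a shift together with a point of $A^S$, and
    \<open>F\<close> performs the shift. A collision of \<open>F\<close> is a common point of two
    translates.\<close>
  define T where "T = {0..D} \<times> (S \<rightarrow>\<^sub>E A)"
  define F where "F = (\<lambda>(i, f). \<lambda>j\<in>S. (f j + int i * v j) mod int q)"
  have "F ` T \<subseteq> S \<rightarrow>\<^sub>E {0..<int q}"
    using q by (auto simp: F_def)
  moreover have "finite (S \<rightarrow>\<^sub>E {0..<int q})"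
    using assms(1) by (simp add: finite_PiE)
  moreover have "card (S \<rightarrow>\<^sub>E {0..<int q}) < card T"
    using big assms(1) by (simp add: T_def card_PiE card_cartesian_product)
  ultimately have "\<not> inj_on F T"
    by (metis card_inj_on_le not_le)
  then obtain p p' where pp: "p \<in> T" "p' \<in> T" "F p = F p'" "p \<noteq> p'"
    by (auto simp: inj_on_def)
  note result = that
  \<comment> \<open>Ordering the two shifts makes \<open>i' - i\<close> a positive natural number at
    most \<open>D\<close>; the other order is covered at the end by swapping the two pairs.\<close>
  have *: thesis
    if "i \<le> D" "i' \<le> D" "f \<in> S \<rightarrow>\<^sub>E A" "f' \<in> S \<rightarrow>\<^sub>E A" "F (i, f) = F (i', f')" "i < i'"
    for i i' f f'
  proof (rule result[of "i' - i"])
    fix j assume j: "j \<in> S"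
    have "(f j + int i * v j) mod int q = (f' j + int i' * v j) mod int q"
      using fun_cong[OF \<open>F (i, f) = F (i', f')\<close>, of j] j by (simp add: F_def)
    then have "int q dvd (f j + int i * v j) - (f' j + int i' * v j)"
      by (simp add: mod_eq_dvd_iff)
    moreover have "int (i' - i) * v j - (f j - f' j)
        = - ((f j + int i * v j) - (f' j + int i' * v j))"
      using \<open>i < i'\<close> by (simp add: of_nat_diff algebra_simps)
    ultimately have "int q dvd int (i' - i) * v j - (f j - f' j)"
      by (metis dvd_minus_iff)
    then have "(int (i' - i) * v j) mod int q = (f j - f' j) mod int q"
      by (simp add: mod_eq_dvd_iff)
    then show "\<exists>a\<in>A. \<exists>a'\<in>A. (int (i' - i) * v j) mod int q = (a - a') mod int q"
      using that(3,4) j by (meson PiE_mem)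
  qed (use that in auto)
  obtain i f i' f' where p: "p = (i, f)" "p' = (i', f')"
    by (metis surj_pair)
  have mem: "i \<le> D" "i' \<le> D" "f \<in> S \<rightarrow>\<^sub>E A" "f' \<in> S \<rightarrow>\<^sub>E A"
    using pp p by (auto simp: T_def)
  \<comment> \<open>A translate cannot collide with itself: elements of \<open>A\<close> are reduced
    residues, so congruent coordinates are equal. This gives \<open>1 \<le> d\<close>.\<close>
  have "i \<noteq> i'"
  proof
    assume i: "i = i'"
    have "f = f'"
    proof (rule PiE_ext[OF mem(3,4)])
      fix j assume j: "j \<in> S"
      have "(f j + int i * v j) mod int q = (f' j + int i * v j) mod int q"
        using fun_cong[OF pp(3), of j] j p i by (simp add: F_def)
      then have "f j mod int q = f' j mod int q"
        by (simp add: mod_eq_dvd_iff)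
      moreover have "f j \<in> {0..<int q}" "f' j \<in> {0..<int q}"
        using PiE_mem[OF mem(3) j] PiE_mem[OF mem(4) j] A by auto
      ultimately show "f j = f' j" by simp
    qed
    with pp(4) p i show False by simp
  qed
  then consider "i < i'" | "i' < i" by linarith
  then show thesis
    using *[OF mem] *[OF mem(2,1,4,3)] pp(3) p by cases simp_all
qed

text \<open>A prime dividing both \<open>j\<close> and \<open>q\<close> would be a prime factor of
  \<open>q\<close> that is at most \<open>j\<close>.\<close>

lemma coprime_less_least_prime_factor:
  assumes "q > 0" "1 \<le> j" "ereal (real j) < least_prime_factor q"
  shows "coprime j q"
proof (rule ccontr)
  assume "\<not> coprime j q"
  then obtain p where p: "prime p" "p dvd j" "p dvd q"
    using prime_factor_nat[of "gcd j q"] unfolding coprime_iff_gcd_eq_1 by auto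
  have "least_prime_factor q \<le> ereal (real p)"
    unfolding least_prime_factor_def
    using p assms(1) by (intro INF_lower) (auto simp: prime_factors_dvd)
  also have "p \<le> j" using p assms(2) by (auto intro: dvd_imp_le)
  finally show False using assms(3) by simp
qed

lemma difference_set_Zmod:
  assumes "X \<subseteq> carrier (Zmod q)" "Y \<subseteq> carrier (Zmod q)"
  shows "difference_set (Zmod q) X Y = {(x - y) mod int q | x y. x \<in> X \<and> y \<in> Y}"
proof -
  have "(\<exists>x y. z = x \<ominus>\<^bsub>Zmod q\<^esub> y \<and> x \<in> X \<and> y \<in> Y)
      \<longleftrightarrow> (\<exists>x y. z = (x - y) mod int q \<and> x \<in> X \<and> y \<in> Y)" for z
    by (intro ex_cong1) (use assms minus_Zmod in \<open>auto simp: subset_iff\<close>)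
  then show ?thesis
    by (simp add: difference_set_def)
qed

theorem theorem20:
  fixes q :: nat and A B :: "int set" and \<alpha> \<beta> :: real
  assumes "q > 0"
    and "A \<subseteq> carrier (Zmod q)" and "B \<subseteq> carrier (Zmod q)"
    and "A \<noteq> {}" and "B \<noteq> {}"
    and "real (card A) = \<alpha> * real q" and "real (card B) = \<beta> * real q"
    and "\<alpha> \<ge> \<beta>"
    and "least_prime_factor q > ereal (2 * inverse \<beta> + 3)"
  shows "\<exists>d :: nat. d > 0 \<and> real d \<le> \<alpha> powr (- inverse \<beta> - 1) \<and>
           dilate (Zmod q) d (carrier (Zmod q))
             \<subseteq> difference_set (Zmod q) A A <#>\<^bsub>Zmod q\<^esub> difference_set (Zmod q) B B"
proof -
  define n where "n = nat \<lfloor>inverse \<beta>\<rfloor>"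
  define D where "D = nat \<lfloor>inverse \<alpha> ^ n\<rfloor>"
  note carr = carrier_Zmod[of q]
  have A: "A \<subseteq> {0..<int q}" and B: "B \<subseteq> {0..<int q}"
    using assms(2,3) by (auto simp: carr)
  have "card A > 0" "card B > 0"
    using A B assms(4,5) by (auto simp: card_gt_0_iff intro: finite_subset)
  then have pos: "\<alpha> > 0" "\<beta> > 0"
    using assms(1,6,7) by (metis of_nat_0_less_iff zero_less_mult_pos2)+
  have "card A \<le> q" using card_mono[OF _ A] by simp
  then have "\<alpha> * real q \<le> 1 * real q"
    using assms(6) by simp
  then have \<alpha>1: "\<alpha> \<le> 1" using assms(1) by simp
  have n: "real n \<le> inverse \<beta>" "inverse \<beta> < real (Suc n)"
    using pos by (simp_all add: n_def of_nat_nat) linarith+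
  have D: "real D \<le> inverse \<alpha> ^ n" "inverse \<alpha> ^ n < real (Suc D)"
    using pos by (simp_all add: D_def of_nat_nat) linarith+

  have unit: "\<exists>w. (int j * w) mod int q = 1 mod int q" if "j \<in> {1..n}" for j
  proof -
    have "real j < 2 * inverse \<beta> + 3"
      using that n(1) pos by (smt (verit) atLeastAtMost_iff inverse_positive_iff_positive of_nat_mono)
    then have "ereal (real j) < least_prime_factor q"
      using assms(9) less_trans less_ereal.simps(1) by blast
    then have "coprime j q"
      using that assms(1) by (intro coprime_less_least_prime_factor) auto
    then show ?thesis
      using cong_solve_coprime_int[of "int j" "int q"] by (auto simp: cong_def)
  qed
  \<comment> \<open>\<open>w j\<close> represents $1/j$ modulo \<open>q\<close>.\<close>
  then obtain w where w: "\<And>j. j \<in> {1..n} \<Longrightarrow> (int j * w j) mod int q = 1 mod int q"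
    by metis

  have "real (q ^ n) = inverse \<alpha> ^ n * real (card A) ^ n"
    using pos by (simp add: assms(6) power_mult_distrib power_inverse field_simps)
  also have "\<dots> < real (Suc D) * real (card A) ^ n"
    using D(2) \<open>card A > 0\<close> by (intro mult_strict_right_mono) auto
  finally have "q ^ n < Suc D * card A ^ n"
    by (metis of_nat_less_iff of_nat_mult of_nat_power)
  then obtain d where d: "1 \<le> d" "d \<le> D"
    and dA: "\<And>j. j \<in> {1..n} \<Longrightarrow> \<exists>a\<in>A. \<exists>a'\<in>A. (int d * w j) mod int q = (a - a') mod int q"
    using simultaneous_multiple_in_difference_set[of "{1..n}" q A D w] A assms(1) by auto

  have "real q = inverse \<beta> * real (card B)"
    using pos assms(7) by simp
  also have "\<dots> < real (Suc n) * real (card B)"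
    using n(2) \<open>card B > 0\<close> by (intro mult_strict_right_mono) auto
  finally have qB: "q < Suc n * card B"
    by (metis of_nat_less_iff of_nat_mult)

  have "real d \<le> inverse \<alpha> ^ n" using d(2) D(1) by linarith
  also have "\<dots> = \<alpha> powr (- real n)"
    using pos by (simp add: powr_minus powr_realpow power_inverse)
  also have "\<dots> \<le> \<alpha> powr (- inverse \<beta> - 1)"
    using pos \<alpha>1 n by (intro powr_mono') auto
  finally have "real d \<le> \<alpha> powr (- inverse \<beta> - 1)" .

  moreover have "(int d * x) mod int q
      \<in> difference_set (Zmod q) A A <#>\<^bsub>Zmod q\<^esub> difference_set (Zmod q) B B" for x
  proof -
    obtain j where j: "j \<in> {1..n}"
      and "\<exists>b\<in>B. \<exists>b'\<in>B. (int j * x) mod int q = (b - b') mod int q"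
      \<comment> \<open>With one coordinate the hypothesis is exactly \<open>qB\<close>. Taking
        \<open>n\<close> as the bound on the multiplier puts \<open>j\<close> in the range where
        \<open>w j\<close> and \<open>dA\<close> are available.\<close>
      by (rule simultaneous_multiple_in_difference_set[of "{()}" q B n "\<lambda>_. x"])
        (use B assms(1) qB in auto)
    then obtain b b' where b: "b \<in> B" "b' \<in> B"
      and jb: "(int j * x) mod int q = (b - b') mod int q"
      by blast
    obtain a a' where a: "a \<in> A" "a' \<in> A"
      and da: "(int d * w j) mod int q = (a - a') mod int q"
      using dA[OF j] by blast
    have "(int d * x) mod int q = (int d * x * ((int j * w j) mod int q)) mod int q"
      by (simp add: w[OF j] mod_simps)
    also have "\<dots> = (((int d * w j) mod int q) * ((int j * x) mod int q)) mod int q"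
      by (simp only: mod_simps) (simp only: ac_simps)
    finally have "(int d * x) mod int q
        = (((a - a') mod int q) * ((b - b') mod int q)) mod int q"
      by (simp only: da jb)
    then show ?thesis
      using a b unfolding set_mult_Zmod difference_set_Zmod[OF assms(2,2)]
        difference_set_Zmod[OF assms(3,3)] by blast
  qed
  ultimately show ?thesis
    using d(1) by (intro exI[of _ d]) (auto simp: dilate_Zmod)
qed

end
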